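(* There are families $\mathcal{F}_1$ and $\mathcal{F}_2$, each consisting of continuum many pairwise non-isomorphic free $\mathbb{F}_\sigma$ P-filters on $\omega$, such that: (A) for every $F\in\mathcal{F}_1$ the space $N_F$ has the Josefson--Nissenzweig property (JNP); (B) for every $F\in\mathcal{F}_2$ the space $N_F$ has the bounded Josefson--Nissenzweig property (BJNP) but does not have the JNP.
   Context: A filter $F$ on $\omega$ is free if $\bigcap F=\emptyset$ (equivalently, $F$ contains every cofinite set); filters are proper. $F$ is a P-filter if for every sequence $\langle A_n\rangle$ in $F$ there is $A\in F$ with $A\setminus A_n$ finite for every $n$. Filters are viewed as subsets of the Cantor space $2^\omega$ via characteristic functions; "$\mathbb{F}_\sigma$" refers to this. Filters $F,G$ on $\omega$ are isomorphic if there is a bijection $f:\omega\to\omega$ with $F=\{A\subseteq\omega: f^{-1}[A]\in G\}$. For a free filter $F$ on $\omega$, $N_F=\omega\cup\{p_F\}$, $p_F\notin\omega$, with the topology in which every point of $\omega$ is isolated and the open neighborhoods of $p_F$ are exactly the sets $A\cup\{p_F\}$ with $A\in F$. A finitely supported measure on a Tychonoff space $X$ is $\mu=\sum_{i=1}^n\alpha_i\delta_{x_i}$ with distinct $x_i\in X$ and $\alpha_i\in\mathbb{R}\setminus\{0\}$; $\|\mu\|=\sum_i|\alpha_i|$, $\mu(f)=\sum_i\alpha_i f(x_i)$. $X$ has the JNP (resp. the BJNP) if there is a sequence $\langle\mu_n: n\in\omega\rangle$ of finitely supported measures on $X$ with $\|\mu_n\|=1$ for all $n$ and $\mu_n(f)\to0$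 for every continuous (resp. bounded continuous) $f:X\to\mathbb{R}$. *)

theory Defs
  imports "HOL-Analysis.Analysis" "HOL-Library.Poly_Mapping"
begin

section \<open>Filters on the natural numbers\<close>

text \<open>
  The type \<^typ>\<open>'a filter\<close> contains one improper filter, \<^term>\<open>bot\<close>. The filter as a family of
  sets is recovered by the following function, which is injective.
\<close>

definition filter_sets :: "'a filter \<Rightarrow> 'a set set" where
  "filter_sets F = {A. eventually (\<lambda>x. x \<in> A) F}"

lemma filter_sets_inject: "filter_sets F = filter_sets G \<longleftrightarrow> F = G"
proof
  assume "filter_sets F = filter_sets G"
  then have "{x. P x} \<in> filter_sets F \<longleftrightarrow> {x. P x} \<in> filter_sets G" for P
    by simp
  then show "F = G"
    by (simp add: filter_sets_def filter_eq_iff)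
qed simp

definition free_filter :: "'a filter \<Rightarrow> bool" where
  "free_filter F \<longleftrightarrow> F \<noteq> bot \<and> \<Inter>(filter_sets F) = {}"

definition P_filter :: "nat filter \<Rightarrow> bool" where
  "P_filter F \<longleftrightarrow>
     (\<forall>A :: nat \<Rightarrow> nat set. range A \<subseteq> filter_sets F \<longrightarrow>
        (\<exists>B \<in> filter_sets F. \<forall>n. finite (B - A n)))"

definition Cantor_space :: "(nat \<Rightarrow> bool) topology" where
  "Cantor_space = product_topology (\<lambda>_. discrete_topology UNIV) UNIV"

definition fsigma_filter :: "nat filter \<Rightarrow> bool" where
  "fsigma_filter F \<longleftrightarrow> fsigma_in Cantor_space ((\<lambda>A n. n \<in> A) ` filter_sets F)"

definition filter_isomorphic :: "nat filter \<Rightarrow> nat filter \<Rightarrow> bool" where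
  "filter_isomorphic F G \<longleftrightarrow>
     (\<exists>f :: nat \<Rightarrow> nat. bij f \<and> filter_sets F = {A. f -` A \<in> filter_sets G})"

section \<open>The space of a filter\<close>

text \<open>
  The point \<^term>\<open>Some n\<close> stands for \<open>n\<close>, and \<^term>\<open>None\<close> for the extra point \<open>p\<^sub>F\<close>.
\<close>

definition filter_space :: "nat filter \<Rightarrow> nat option topology" where
  "filter_space F = topology (\<lambda>U. None \<in> U \<longrightarrow> Some -` U \<in> filter_sets F)"

lemma openin_filter_space:
  "openin (filter_space F) U \<longleftrightarrow> (None \<in> U \<longrightarrow> Some -` U \<in> filter_sets F)"
proof -
  have "istopology (\<lambda>U. None \<in> U \<longrightarrow> Some -` U \<in> filter_sets F)"
    unfolding istopology_def filter_sets_def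
    by (fastforce intro: eventually_conj elim: eventually_mono)
  then show ?thesis
    by (simp add: filter_space_def topology_inverse')
qed

lemma openin_filter_space_Some: "openin (filter_space F) {Some n}"
  by (simp add: openin_filter_space)

lemma open_nbhd_filter_space_None:
  "openin (filter_space F) U \<and> None \<in> U \<longleftrightarrow> (\<exists>A \<in> filter_sets F. U = insert None (Some ` A))"
proof
  assume "openin (filter_space F) U \<and> None \<in> U"
  then have "Some -` U \<in> filter_sets F" "U = insert None (Some ` (Some -` U))"
    by (auto simp: openin_filter_space image_iff)
  then show "\<exists>A \<in> filter_sets F. U = insert None (Some ` A)"
    by blast
next
  assume "\<exists>A \<in> filter_sets F. U = insert None (Some ` A)"
  moreover have "Some -` (insert None (Some ` A)) = A" for A :: "nat set"
    by auto
  ultimately show "openin (filter_space F) U \<and> None \<in> U"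
    by (auto simp: openin_filter_space)
qed

lemma topspace_filter_space [simp]: "topspace (filter_space F) = UNIV"
proof -
  have "openin (filter_space F) UNIV"
    by (simp add: openin_filter_space filter_sets_def)
  then show ?thesis
    using openin_subset by blast
qed

section \<open>The Josefson--Nissenzweig properties\<close>

text \<open>
  A finitely supported measure \<open>\<Sum>i\<le>n. \<alpha>\<^sub>i \<delta>\<^bsub>x\<^sub>i\<^esub>\<close> is represented by the finitely supported function
  sending each \<open>x\<^sub>i\<close> to its weight \<open>\<alpha>\<^sub>i\<close>, so that \<^const>\<open>Poly_Mapping.keys\<close> is the set of the \<open>x\<^sub>i\<close>.
\<close>

type_synonym 'a fs_measure = "'a \<Rightarrow>\<^sub>0 real"

definition fs_measure_on :: "'a topology \<Rightarrow> 'a fs_measure \<Rightarrow> bool" where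
  "fs_measure_on X \<mu> \<longleftrightarrow> Poly_Mapping.keys \<mu> \<subseteq> topspace X"

definition fs_norm :: "'a fs_measure \<Rightarrow> real" where
  "fs_norm \<mu> = (\<Sum>x \<in> Poly_Mapping.keys \<mu>. \<bar>Poly_Mapping.lookup \<mu> x\<bar>)"

definition fs_integral :: "'a fs_measure \<Rightarrow> ('a \<Rightarrow> real) \<Rightarrow> real" where
  "fs_integral \<mu> f = (\<Sum>x \<in> Poly_Mapping.keys \<mu>. Poly_Mapping.lookup \<mu> x * f x)"

text \<open>
  Both properties are meant for Tychonoff spaces; spaces of free filters are such, see
  \<open>Tychonoff_filter_space\<close> below.
\<close>

definition JNP :: "'a topology \<Rightarrow> bool" where
  "JNP X \<longleftrightarrow>
     (\<exists>\<mu> :: nat \<Rightarrow> 'a fs_measure.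
        (\<forall>n. fs_measure_on X (\<mu> n) \<and> fs_norm (\<mu> n) = 1) \<and>
        (\<forall>f. continuous_map X euclideanreal f \<longrightarrow> (\<lambda>n. fs_integral (\<mu> n) f) \<longlonglongrightarrow> 0))"

definition BJNP :: "'a topology \<Rightarrow> bool" where
  "BJNP X \<longleftrightarrow>
     (\<exists>\<mu> :: nat \<Rightarrow> 'a fs_measure.
        (\<forall>n. fs_measure_on X (\<mu> n) \<and> fs_norm (\<mu> n) = 1) \<and>
        (\<forall>f. continuous_map X euclideanreal f \<and> bounded (f ` topspace X) \<longrightarrow>
           (\<lambda>n. fs_integral (\<mu> n) f) \<longlonglongrightarrow> 0))"

lemma Tychonoff_filter_space:
  assumes "free_filter F"
  shows "completely_regular_space (filter_space F)" "Hausdorff_space (filter_space F)"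
proof -
  have compl: "openin (filter_space F) (- {Some n})" for n
  proof -
    have "n \<notin> \<Inter>(filter_sets F)"
      using assms by (simp add: free_filter_def)
    then obtain A where "eventually (\<lambda>x. x \<in> A) F" "n \<notin> A"
      by (auto simp: filter_sets_def)
    then show ?thesis
      by (auto simp: openin_filter_space filter_sets_def elim: eventually_mono)
  qed
  have None_clopen: "openin (filter_space F) (- U)" if "None \<in> U" for U
    using that by (simp add: openin_filter_space)
  have sep: "\<exists>U. openin (filter_space F) U \<and> openin (filter_space F) (- U) \<and> x \<in> U \<and> U \<subseteq> V"
    if "openin (filter_space F) V" "x \<in> V" for x V
    using that compl openin_filter_space_Some None_clopen
    by (cases x) (metis order_refl, metis empty_subsetI insert_subset singletonI)
  show "completely_regular_space (filter_space F)"
    unfolding completely_regular_space_def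
  proof (intro allI impI)
    fix S x
    assume S: "closedin (filter_space F) S \<and> x \<in> topspace (filter_space F) - S"
    then have "openin (filter_space F) (- S)" "x \<in> - S"
      by (auto simp: closedin_def Compl_eq_Diff_UNIV)
    then obtain U where U: "openin (filter_space F) U" "openin (filter_space F) (- U)" "x \<in> U" "U \<subseteq> - S"
      using sep by meson
    let ?f = "\<lambda>y. if y \<in> U then 0 else 1 :: real"
    have "openin (filter_space F) {y. ?f y \<in> W}" for W
    proof -
      have "{y. ?f y \<in> W} = (if 0 \<in> W then U else {}) \<union> (if 1 \<in> W then - U else {})"
        by auto
      then show ?thesis
        using U openin_topspace[of "filter_space F"] by (auto simp del: openin_topspace)
    qed
    then have "continuous_map (filter_space F) (top_of_set {0..1}) ?f"
      by (auto simp: continuous_map_in_subtopology continuous_map_def)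
    then show "\<exists>f. continuous_map (filter_space F) (top_of_set {0..1}) f \<and> f x = (0::real) \<and> f ` S \<subseteq> {1}"
      using U by (intro exI[of _ ?f]) auto
  qed
  show "Hausdorff_space (filter_space F)"
    unfolding Hausdorff_space_def
  proof (intro allI impI)
    fix x y :: "nat option"
    assume "x \<in> topspace (filter_space F) \<and> y \<in> topspace (filter_space F) \<and> x \<noteq> y"
    then have "x \<noteq> y" by simp
    then show "\<exists>U V. openin (filter_space F) U \<and> openin (filter_space F) V \<and> x \<in> U \<and> y \<in> V \<and> disjnt U V"
    proof (cases x)
      case (Some n)
      then show ?thesis
        using compl[of n] openin_filter_space_Some[of F n] \<open>x \<noteq> y\<close>
        by (intro exI[of _ "{x}"] exI[of _ "- {x}"]) (auto simp: disjnt_def)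
    next
      case None
      then obtain m where "y = Some m"
        using \<open>x \<noteq> y\<close> by (cases y) auto
      then show ?thesis
        using compl[of m] openin_filter_space_Some[of F m] \<open>x \<noteq> y\<close>
        by (intro exI[of _ "- {y}"] exI[of _ "{y}"]) (auto simp: disjnt_def)
    qed
  qed
qed

end

theory Submission
  imports Defs
begin

text \<open>
  All filters are duals of ideals \<open>{A. \<Sum>k\<in>A. w k < \<infinity>}\<close> for a weight \<open>w \<ge> 0\<close> with divergent sum; these
  are \<open>F\<^sub>\<sigma>\<close> P-filters. If \<open>w\<close> equals \<open>1\<close> infinitely often, the space contains a nontrivial convergent
  sequence, which gives the JNP. If \<open>w\<close> tends to \<open>0\<close>, every infinite set contains an infinite one in
  the ideal, on which a function vanishing elsewhere may take arbitrary values and still be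
  continuous; a gliding hump then excludes the JNP. The BJNP survives if
  there are infinitely many disjoint finite sets on which \<open>w\<close> is constant with total mass \<open>1\<close>: use
  the averages over them.

  To get continuum many isomorphism types, fix disjoint blocks of very rapidly growing sizes, and for
  \<open>X \<subseteq> \<nat>\<close> spread mass \<open>1\<close> uniformly over the \<open>n\<close>-th block for \<open>n \<in> X\<close> and mass \<open>0\<close> for \<open>n \<notin> X\<close>. If
  \<open>n \<in> X - Y\<close>, a bijection cannot send most of block \<open>n\<close> into the far smaller earlier blocks, so at
  least half of it lands on points whose weight with respect to \<open>Y\<close> is negligible. Hence the filters
  for \<open>X\<close> and \<open>Y\<close> are not isomorphic when \<open>X - Y\<close> is infinite.
\<close>

section \<open>Summable ideals\<close>

lemma bounded_imp_summable_on:
  fixes w :: "'a \<Rightarrow> real"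
  assumes "\<And>x. 0 \<le> w x" and "\<And>G. finite G \<Longrightarrow> G \<subseteq> A \<Longrightarrow> sum w G \<le> c"
  shows "w summable_on A"
  by (rule nonneg_bdd_above_summable_on) (auto intro!: bdd_aboveI[of _ c] simp: assms)

text \<open>A finite \<open>F\<close> already carries all but \<open>e / 2\<close> of the mass, so a
  finite set beyond it can only add what remains. Most later uses of summability go through this
  form.\<close>

lemma summable_on_tail:
  fixes w :: "nat \<Rightarrow> real"
  assumes "\<And>x. 0 \<le> w x" "w summable_on A" "0 < e"
  shows "\<exists>K. \<forall>G. finite G \<longrightarrow> G \<subseteq> A \<inter> {K..} \<longrightarrow> sum w G < e"
proof -
  obtain F where F: "finite F" "F \<subseteq> A" "dist (sum w F) (infsum w A) \<le> e / 2"
    using infsum_finite_approximation[OF assms(2), of "e/2"] assms(3) by auto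
  obtain K where K: "F \<subseteq> {..<K}"
    using finite_nat_iff_bounded[of F] F by blast
  have "sum w G < e" if G: "finite G" "G \<subseteq> A \<inter> {K..}" for G
  proof -
    have "sum w (F \<union> G) \<le> infsum w A"
      using F G assms by (intro finite_sum_le_infsum) auto
    moreover have "sum w (F \<union> G) = sum w F + sum w G"
      using F G K by (intro sum.union_disjoint) fastforce+
    ultimately show ?thesis
      using F(3) assms(3) unfolding dist_real_def by linarith
  qed
  then show ?thesis by blast
qed

lemma summable_on_UN_geometric:
  fixes w :: "'a \<Rightarrow> real" and I :: "nat set"
  assumes nn: "\<And>x. 0 \<le> w x"
    and C: "\<And>n G. n \<in> I \<Longrightarrow> finite G \<Longrightarrow> G \<subseteq> C n \<Longrightarrow> sum w G \<le> (1/2)^n"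
  shows "w summable_on (\<Union>n\<in>I. C n)"
proof (rule bounded_imp_summable_on)
  fix G assume G: "finite G" "G \<subseteq> (\<Union>n\<in>I. C n)"
  then have "\<forall>x\<in>G. \<exists>n\<in>I. x \<in> C n" by auto
  \<comment> \<open>The sets \<open>C n\<close> may overlap, so each point is charged to one chosen
    index.\<close>
  then obtain g where g: "\<And>x. x \<in> G \<Longrightarrow> g x \<in> I \<and> x \<in> C (g x)" by metis
  have "sum w G = (\<Sum>n\<in>g ` G. sum w {x \<in> G. g x = n})"
    by (rule sum.image_gen[OF G(1)])
  also have "\<dots> \<le> (\<Sum>n\<in>g ` G. (1/2)^n)"
    using G by (intro sum_mono C) (auto dest: g)
  also have "\<dots> \<le> suminf ((^) (1/2))"
    using G by (intro sum_le_suminf) auto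
  also have "\<dots> = (2::real)"
    using suminf_geometric[of "1/2 :: real"] by simp
  finally show "sum w G \<le> 2" .
qed (rule nn)

text \<open>Since \<open>w\<close> tends to 0 along \<open>E\<close>, one can pick the n-th point
  with weight at most \<open>(1/2)^n\<close> and compare with the geometric series.\<close>

lemma infinite_summable_subset:
  fixes w :: "nat \<Rightarrow> real"
  assumes nn: "\<And>x. 0 \<le> w x" and E: "infinite E"
    and small: "\<And>e. 0 < e \<Longrightarrow> finite {k \<in> E. w k > e}"
  shows "\<exists>A \<subseteq> E. infinite A \<and> w summable_on A"
proof -
  have "\<exists>k. k \<in> E \<and> n \<le> k \<and> w k \<le> (1/2)^n" for n
  proof -
    have "infinite (E - ({k \<in> E. w k > (1/2)^n} \<union> {..<n}))"
      using E small[of "(1/2)^n"] by simp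
    then obtain k where "k \<in> E - ({k \<in> E. w k > (1/2)^n} \<union> {..<n})"
      using infinite_imp_nonempty by blast
    then show ?thesis by (intro exI[of _ k]) auto
  qed
  then obtain a where a: "\<And>n. a n \<in> E \<and> n \<le> a n \<and> w (a n) \<le> (1/2)^n" by metis
  \<comment> \<open>The choice \<open>a\<close> may repeat values; \<open>n \<le> a n\<close> makes
    its range unbounded all the same.\<close>
  have "infinite (range a)"
    unfolding infinite_nat_iff_unbounded_le using a by blast
  moreover have "w summable_on (\<Union>n\<in>UNIV. {a n})"
  proof (rule summable_on_UN_geometric[OF nn])
    fix n G assume "finite G" "G \<subseteq> {a n}"
    then have "sum w G \<le> sum w {a n}"
      using nn by (intro sum_mono2) auto
    then show "sum w G \<le> (1/2)^n" using a[of n] by simp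
  qed
  moreover have "(\<Union>n\<in>UNIV. {a n}) = range a" by auto
  ultimately show ?thesis using a by (intro exI[of _ "range a"]) auto
qed

section \<open>Filters dual to summable ideals\<close>

definition summable_filter :: "(nat \<Rightarrow> real) \<Rightarrow> nat filter" where
  "summable_filter w = Abs_filter (\<lambda>P. w summable_on {x. \<not> P x})"

text \<open>Summability of reals passes to subsets, which gives upward closure, and to disjoint
  unions, which gives closure under intersection.\<close>

lemma eventually_summable_filter:
  "eventually P (summable_filter w) \<longleftrightarrow> w summable_on {x. \<not> P x}"
proof -
  have "is_filter (\<lambda>P. w summable_on {x. \<not> P x})"
  proof
    fix P Q assume "w summable_on {x. \<not> P x}" "w summable_on {x. \<not> Q x}"
    then have "w summable_on ({x. \<not> P x} \<union> ({x. \<not> Q x} - {x. \<not> P x}))"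
      by (intro summable_on_Un_disjoint) (auto intro: summable_on_subset_banach)
    moreover have "{x. \<not> P x} \<union> ({x. \<not> Q x} - {x. \<not> P x}) = {x. \<not> (P x \<and> Q x)}" by auto
    ultimately show "w summable_on {x. \<not> (P x \<and> Q x)}" by simp
  next
    fix P Q assume "\<forall>x. P x \<longrightarrow> Q x" "w summable_on {x. \<not> P x}"
    then show "w summable_on {x. \<not> Q x}"
      by (auto intro: summable_on_subset_banach)
  qed simp
  then show ?thesis
    by (simp add: summable_filter_def eventually_Abs_filter)
qed

lemma mem_filter_sets_summable_filter:
  "A \<in> filter_sets (summable_filter w) \<longleftrightarrow> w summable_on (- A)"
  by (simp add: filter_sets_def eventually_summable_filter Collect_neg_eq)

lemma free_summable_filter:
  assumes "\<not> w summable_on UNIV"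
  shows "free_filter (summable_filter w)"
proof -
  have "- {n} \<in> filter_sets (summable_filter w)" for n
    by (simp add: mem_filter_sets_summable_filter)
  then have "\<Inter>(filter_sets (summable_filter w)) = {}" by blast
  then show ?thesis
    using assms by (simp add: free_filter_def trivial_limit_def eventually_summable_filter)
qed

text \<open>Removing a finite head from the complement of \<open>A n\<close> leaves a tail of mass
  below \<open>(1/2)^n\<close>. The union of these tails is in the ideal, and its complement is the
  pseudo-intersection.\<close>

lemma P_summable_filter:
  assumes nn: "\<And>x. 0 \<le> w x"
  shows "P_filter (summable_filter w)"
  unfolding P_filter_def
proof (intro allI impI)
  fix A :: "nat \<Rightarrow> nat set" assume "range A \<subseteq> filter_sets (summable_filter w)"
  then have A: "w summable_on (- A n)" for n
    by (auto simp flip: mem_filter_sets_summable_filter)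
  have "\<exists>K. \<forall>G. finite G \<longrightarrow> G \<subseteq> - A n \<inter> {K..} \<longrightarrow> sum w G < (1/2)^n" for n
    by (rule summable_on_tail[OF nn A]) simp
  then obtain K where K: "\<And>n G. finite G \<Longrightarrow> G \<subseteq> - A n \<inter> {K n..} \<Longrightarrow> sum w G < (1/2)^n"
    by metis
  let ?B = "- (\<Union>n\<in>UNIV. - A n \<inter> {K n..})"
  have "w summable_on (\<Union>n\<in>UNIV. - A n \<inter> {K n..})"
    by (rule summable_on_UN_geometric[OF nn]) (meson K less_imp_le)
  then have "?B \<in> filter_sets (summable_filter w)"
    unfolding mem_filter_sets_summable_filter double_complement .
  moreover have "finite (?B - A n)" for n
    by (rule finite_subset[of _ "{..<K n}"]) (auto simp: not_le)
  ultimately show "\<exists>B\<in>filter_sets (summable_filter w). \<forall>n. finite (B - A n)" by blast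
qed

lemma topspace_Cantor_space [simp]: "topspace Cantor_space = UNIV"
  by (simp add: Cantor_space_def)

text \<open>Membership means that some bound \<open>M\<close> holds for all partial sums over the
  complement, and each partial sum is continuous because it depends on finitely many
  coordinates.\<close>

lemma fsigma_summable_filter:
  assumes nn: "\<And>x. 0 \<le> w x"
  shows "fsigma_filter (summable_filter w)"
proof -
  \<comment> \<open>Here \<open>x\<close> is the characteristic function of a candidate member, so
    only points outside the member are summed.\<close>
  define C where "C M n = {x :: nat \<Rightarrow> bool. (\<Sum>k<n. if x k then 0 else w k) \<le> real M}" for M n :: nat
  have "closedin Cantor_space (C M n)" for M n
  proof -
    have "continuous_map Cantor_space euclideanreal (\<lambda>x. if x k then 0 else w k)" for k
    proof -
      have "continuous_map Cantor_space (discrete_topology UNIV) (\<lambda>x. x k)"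
        unfolding Cantor_space_def by (rule continuous_map_product_projection) simp
      moreover have "continuous_map (discrete_topology UNIV) euclideanreal (\<lambda>b. if b then 0 else w k)"
        by simp
      ultimately show ?thesis
        using continuous_map_compose[unfolded o_def] by fast
    qed
    then have "continuous_map Cantor_space euclideanreal (\<lambda>x. \<Sum>k<n. if x k then 0 else w k)"
      by (intro continuous_map_sum) auto
    from closedin_continuous_map_preimage[OF this, of "{..real M}"] show ?thesis
      by (simp add: C_def)
  qed
  then have *: "fsigma_in Cantor_space (\<Union>(range (\<lambda>M. \<Inter>n. C M n)))"
    by (intro fsigma_in_Union) (auto intro: closed_imp_fsigma_in)
  have "w summable_on (- A) \<longleftrightarrow> (\<exists>M. \<forall>n. (\<lambda>k. k \<in> A) \<in> C M n)" for A
  proof -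
    have C: "(\<lambda>k. k \<in> A) \<in> C M n \<longleftrightarrow> sum w ({..<n} - A) \<le> real M" for M n
      by (simp add: C_def if_distrib sum.If_cases Diff_eq Int_commute cong: if_cong)
    show ?thesis
    proof
      assume *: "w summable_on (- A)"
      obtain M where "infsum w (- A) \<le> real M" using real_arch_simple by blast
      moreover have "sum w ({..<n} - A) \<le> infsum w (- A)" for n
        using * nn by (intro finite_sum_le_infsum) auto
      ultimately show "\<exists>M. \<forall>n. (\<lambda>k. k \<in> A) \<in> C M n"
        unfolding C by (meson order_trans)
    next
      assume "\<exists>M. \<forall>n. (\<lambda>k. k \<in> A) \<in> C M n"
      then obtain M where M: "\<And>n. sum w ({..<n} - A) \<le> real M"
        unfolding C by blast
      show "w summable_on (- A)"
      proof (rule bounded_imp_summable_on[OF nn])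
        fix G assume G: "finite G" "G \<subseteq> - A"
        then obtain n where "G \<subseteq> {..<n}" using finite_nat_iff_bounded by blast
        then have "sum w G \<le> sum w ({..<n} - A)"
          using G nn by (intro sum_mono2) auto
        then show "sum w G \<le> real M" using M[of n] by linarith
      qed
    qed
  qed
  then have "(\<lambda>A n. n \<in> A) ` filter_sets (summable_filter w) = \<Union>(range (\<lambda>M. \<Inter>n. C M n))"
  proof (intro set_eqI)
    fix x :: "nat \<Rightarrow> bool"
    have "x \<in> (\<lambda>A n. n \<in> A) ` filter_sets (summable_filter w) \<longleftrightarrow>
        Collect x \<in> filter_sets (summable_filter w)"
      by (auto simp: image_iff intro!: bexI[of _ "Collect x"])
    then show "x \<in> (\<lambda>A n. n \<in> A) ` filter_sets (summable_filter w) \<longleftrightarrow> x \<in> \<Union>(range (\<lambda>M. \<Inter>n. C M n))"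
      using \<open>\<And>A. w summable_on (- A) \<longleftrightarrow> _\<close>[of "Collect x"] by (simp add: mem_filter_sets_summable_filter)
  qed
  with * show ?thesis by (simp add: fsigma_filter_def)
qed

text \<open>Restates isomorphism in terms of ideals; \<open>g\<close> is the inverse of the given
  bijection.\<close>

lemma filter_isomorphic_summable_filterE:
  assumes "filter_isomorphic (summable_filter w) (summable_filter v)"
  obtains g where "bij g" "\<And>B. w summable_on B \<longleftrightarrow> (\<lambda>k. v (g k)) summable_on B"
proof -
  obtain f :: "nat \<Rightarrow> nat" where f: "bij f"
    "filter_sets (summable_filter w) = {A. f -` A \<in> filter_sets (summable_filter v)}"
    using assms by (auto simp: filter_isomorphic_def)
  have "w summable_on B \<longleftrightarrow> (\<lambda>k. v (inv f k)) summable_on B" for B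
  proof -
    have "w summable_on B \<longleftrightarrow> - B \<in> filter_sets (summable_filter w)"
      by (simp add: mem_filter_sets_summable_filter)
    also have "\<dots> \<longleftrightarrow> v summable_on (f -` B)"
      unfolding f(2) by (simp add: mem_filter_sets_summable_filter vimage_Compl)
    also have "\<dots> \<longleftrightarrow> (\<lambda>k. v (inv f k)) summable_on B"
    proof (rule summable_on_reindex_bij_betw[symmetric])
      have "inv f ` B = f -` B" using bij_vimage_eq_inv_image[OF f(1)] by simp
      then show "bij_betw (inv f) B (f -` B)"
        using bij_imp_bij_inv[OF f(1)] by (auto simp: bij_betw_def intro: inj_on_subset)
    qed
    finally show ?thesis .
  qed
  then show thesis using that[of "inv f"] bij_imp_bij_inv[OF f(1)] by blast
qed

section \<open>Measures on the space of a summable filter\<close>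

text \<open>Continuity is an issue at \<open>None\<close> only, all other points being
  isolated.\<close>

lemma continuous_map_filter_space:
  "continuous_map (filter_space F) euclideanreal f \<longleftrightarrow>
     (\<forall>e>0. {k. \<bar>f (Some k) - f None\<bar> < e} \<in> filter_sets F)"
proof
  assume f: "continuous_map (filter_space F) euclideanreal f"
  show "\<forall>e>0. {k. \<bar>f (Some k) - f None\<bar> < e} \<in> filter_sets F"
  proof (intro allI impI)
    fix e :: real assume "0 < e"
    have "openin (filter_space F) {x. f x \<in> ball (f None) e}"
      using openin_continuous_map_preimage[OF f, of "ball (f None) e"] by simp
    then show "{k. \<bar>f (Some k) - f None\<bar> < e} \<in> filter_sets F"
      using \<open>0 < e\<close> by (simp add: openin_filter_space vimage_def dist_real_def abs_minus_commute)
  qed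
next
  assume *: "\<forall>e>0. {k. \<bar>f (Some k) - f None\<bar> < e} \<in> filter_sets F"
  have "Some -` {x. f x \<in> U} \<in> filter_sets F" if "open U" "f None \<in> U" for U
  proof -
    obtain e where e: "0 < e" "ball (f None) e \<subseteq> U"
      using \<open>open U\<close> \<open>f None \<in> U\<close> by (rule openE)
    have "eventually (\<lambda>k. k \<in> {k. \<bar>f (Some k) - f None\<bar> < e}) F"
      using * e by (simp add: filter_sets_def)
    then have "eventually (\<lambda>k. k \<in> Some -` {x. f x \<in> U}) F"
      by (rule eventually_mono) (auto intro!: subsetD[OF e(2)] simp: dist_real_def)
    then show ?thesis by (simp add: filter_sets_def)
  qed
  then show "continuous_map (filter_space F) euclideanreal f"
    by (simp add: continuous_map_def openin_filter_space)
qed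

text \<open>Half the difference between the uniform probability measure on \<open>B\<close> and the
  point mass at \<open>None\<close>. Constants integrate to 0, so only deviations from
  \<open>f None\<close> count.\<close>

definition balanced_measure :: "nat set \<Rightarrow> nat option fs_measure" where
  "balanced_measure B = Abs_poly_mapping (\<lambda>x. case x of None \<Rightarrow> - 1 / 2
     | Some k \<Rightarrow> if k \<in> B then 1 / (2 * real (card B)) else 0)"

lemma
  assumes "finite B" "B \<noteq> {}"
  shows fs_norm_balanced_measure: "fs_norm (balanced_measure B) = 1"
    and fs_integral_balanced_measure:
      "fs_integral (balanced_measure B) f = (\<Sum>k\<in>B. f (Some k) - f None) / (2 * real (card B))"
proof -
  let ?m = "\<lambda>x. case x of None \<Rightarrow> - 1 / 2
     | Some k \<Rightarrow> if k \<in> B then 1 / (2 * real (card B)) else 0"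
  have supp: "{x. ?m x \<noteq> 0} \<subseteq> insert None (Some ` B)"
  proof
    show "x \<in> insert None (Some ` B)" if "x \<in> {x. ?m x \<noteq> 0}" for x
      using that by (cases x) (auto split: if_splits)
  qed
  then have "finite {x. ?m x \<noteq> 0}"
    using assms(1) finite_subset by blast
  then have lookup: "Poly_Mapping.lookup (balanced_measure B) = ?m"
    by (simp add: balanced_measure_def)
  have card: "card B \<noteq> 0" using assms by simp
  have keys: "Poly_Mapping.keys (balanced_measure B) = insert None (Some ` B)"
  proof (intro set_eqI)
    show "x \<in> Poly_Mapping.keys (balanced_measure B) \<longleftrightarrow> x \<in> insert None (Some ` B)" for x
      using card by (cases x) (auto simp: in_keys_iff lookup)
  qed
  have [simp]: "inj_on Some B" by simp
  show "fs_norm (balanced_measure B) = 1"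
    using assms card by (simp add: fs_norm_def keys lookup sum.reindex)
  show "fs_integral (balanced_measure B) f = (\<Sum>k\<in>B. f (Some k) - f None) / (2 * real (card B))"
  proof -
    have "fs_integral (balanced_measure B) f =
        (\<Sum>k\<in>B. f (Some k) / (2 * real (card B))) - f None / 2"
      using assms by (simp add: fs_integral_def keys lookup sum.reindex)
    also have "\<dots> = (\<Sum>k\<in>B. f (Some k)) / (2 * real (card B)) - f None / 2"
      by (simp only: sum_divide_distrib)
    also have "\<dots> = (\<Sum>k\<in>B. f (Some k) - f None) / (2 * real (card B))"
      using card by (simp add: sum_subtractf field_simps)
    finally show ?thesis .
  qed
qed

lemma JNP_summable_filter:
  assumes nn: "\<And>x. 0 \<le> w x" and D: "infinite D" "\<And>k. k \<in> D \<Longrightarrow> w k = 1"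
  shows "JNP (filter_space (summable_filter w))"
  unfolding JNP_def
proof (intro exI[of _ "\<lambda>n. balanced_measure {enumerate D n}"] conjI allI impI)
  fix f assume f: "continuous_map (filter_space (summable_filter w)) euclideanreal f"
  have "(\<lambda>n. f (Some (enumerate D n)) - f None) \<longlonglongrightarrow> 0"
  proof (rule LIMSEQ_I)
    fix e :: real assume "0 < e"
    let ?E = "{k. \<not> \<bar>f (Some k) - f None\<bar> < e}"
    have "w summable_on ?E"
      using f \<open>0 < e\<close> by (auto simp: continuous_map_filter_space mem_filter_sets_summable_filter Collect_neg_eq)
    then obtain K where K: "\<And>G. finite G \<Longrightarrow> G \<subseteq> ?E \<inter> {K..} \<Longrightarrow> sum w G < 1"
      using summable_on_tail[where w = w and A = ?E and e = 1, OF nn] by auto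
    \<comment> \<open>A point of \<open>D\<close> beyond \<open>K\<close> has weight 1, too much for
      the tail of the exceptional set \<open>?E\<close>.\<close>
    have "\<bar>f (Some (enumerate D n)) - f None\<bar> < e" if "n \<ge> K" for n
    proof (rule ccontr)
      assume "\<not> ?thesis"
      then have "sum w {enumerate D n} < 1"
        using le_enumerate[OF D(1), of n] that by (intro K) auto
      then show False using D enumerate_in_set[OF D(1)] by simp
    qed
    then show "\<exists>K. \<forall>n\<ge>K. norm (f (Some (enumerate D n)) - f None - 0) < e"
      by auto
  qed
  from tendsto_divide[OF this tendsto_const[of 2]]
  show "(\<lambda>n. fs_integral (balanced_measure {enumerate D n}) f) \<longlonglongrightarrow> 0"
    by (simp add: fs_integral_balanced_measure)
qed (simp_all add: fs_measure_on_def fs_norm_balanced_measure)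

text \<open>On \<open>B n\<close> the weight is normalized counting, so the proportion of points
  with a large deviation equals their \<open>w\<close>-mass. That mass tends to 0 as
  \<open>B n\<close> moves to infinity, and boundedness of \<open>f\<close> controls its
  contribution.\<close>

lemma BJNP_summable_filter:
  assumes nn: "\<And>x. 0 \<le> w x"
    and B: "\<And>n. finite (B n)" "\<And>n. B n \<noteq> {}" "\<And>n. B n \<subseteq> {n..}"
    and w: "\<And>n k. k \<in> B n \<Longrightarrow> w k = 1 / card (B n)"
  shows "BJNP (filter_space (summable_filter w))"
  unfolding BJNP_def
proof (intro exI[of _ "\<lambda>n. balanced_measure (B n)"] conjI allI impI)
  fix f assume f: "continuous_map (filter_space (summable_filter w)) euclideanreal f \<and>
    bounded (f ` topspace (filter_space (summable_filter w)))"
  then obtain M where M: "0 < M" "\<And>x. \<bar>f x\<bar> \<le> M"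
    by (auto simp: bounded_pos)
  define h where "h k = \<bar>f (Some k) - f None\<bar>" for k
  have hM: "h k \<le> 2 * M" for k
    using M(2)[of "Some k"] M(2)[of None] by (simp add: h_def)
  show "(\<lambda>n. fs_integral (balanced_measure (B n)) f) \<longlonglongrightarrow> 0"
  proof (rule LIMSEQ_I)
    fix e :: real assume e: "0 < e"
    let ?E = "{k. \<not> h k < e}"
    have "w summable_on ?E"
      using f e by (auto simp: continuous_map_filter_space mem_filter_sets_summable_filter
          Collect_neg_eq h_def)
    \<comment> \<open>Deviations are at most \<open>2 * M\<close>, so the bound
      \<open>e / (2 * M)\<close> lets \<open>?E\<close> contribute less than \<open>e\<close> on
      average. The other points contribute at most \<open>e\<close>, and the factor 1/2 in the
      measure absorbs the sum.\<close>
    then obtain K where K: "\<And>G. finite G \<Longrightarrow> G \<subseteq> ?E \<inter> {K..} \<Longrightarrow> sum w G < e / (2 * M)"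
      using summable_on_tail[where w = w and A = ?E and e = "e / (2 * M)", OF nn] e M by auto
    have "\<bar>fs_integral (balanced_measure (B n)) f\<bar> < e" if "n \<ge> K" for n
    proof -
      have card: "real (card (B n)) > 0" using B by (simp add: card_gt_0_iff)
      have "sum h (B n) \<le> (\<Sum>k\<in>B n. e + (if k \<in> ?E then 2 * M else 0))"
        using hM e by (intro sum_mono) (auto simp: less_imp_le intro: order_trans[OF hM])
      also have "\<dots> = e * card (B n) + 2 * M * card (B n \<inter> ?E)"
        using B by (simp add: sum.distrib sum.If_cases)
      also have "real (card (B n \<inter> ?E)) = card (B n) * sum w (B n \<inter> ?E)"
        using card by (simp add: w[of _ n])
      also have "2 * M * (card (B n) * sum w (B n \<inter> ?E)) < 2 * M * (card (B n) * (e / (2 * M)))"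
        using B(1)[of n] B(3)[of n] that card M(1) by (intro mult_strict_left_mono K) auto
      finally have "sum h (B n) < 2 * card (B n) * e"
        using M by (simp add: field_simps)
      then have "sum h (B n) / (2 * card (B n)) < e"
        using card by (simp add: field_simps)
      moreover have "\<bar>fs_integral (balanced_measure (B n)) f\<bar> \<le> sum h (B n) / (2 * card (B n))"
        using B by (simp add: fs_integral_balanced_measure h_def divide_right_mono)
      ultimately show ?thesis by linarith
    qed
    then show "\<exists>K. \<forall>n\<ge>K. norm (fs_integral (balanced_measure (B n)) f - 0) < e"
      by auto
  qed
qed (simp_all add: fs_measure_on_def fs_norm_balanced_measure B)

section \<open>Excluding the JNP by a gliding hump\<close>

lemma fs_integral_superset:
  assumes "finite K" "\<And>x. x \<in> Poly_Mapping.keys \<mu> \<Longrightarrow> x \<notin> K \<Longrightarrow> f x = 0"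
  shows "fs_integral \<mu> f = (\<Sum>x\<in>K. Poly_Mapping.lookup \<mu> x * f x)"
proof -
  have "fs_integral \<mu> f = (\<Sum>x\<in>Poly_Mapping.keys \<mu> \<inter> K. Poly_Mapping.lookup \<mu> x * f x)"
    unfolding fs_integral_def using assms by (intro sum.mono_neutral_right) auto
  also have "\<dots> = (\<Sum>x\<in>K. Poly_Mapping.lookup \<mu> x * f x)"
    using assms by (intro sum.mono_neutral_left) (auto simp: in_keys_iff)
  finally show ?thesis .
qed

text \<open>
  The values on \<open>T\<close> are chosen one after the other so that the functional with coefficients \<open>m t\<close>,
  assumed to have \<open>t\<close> as the last point of its support, takes the value \<open>1\<close>.
\<close>

fun gliding_hump :: "nat set \<Rightarrow> (nat \<Rightarrow> nat \<Rightarrow> real) \<Rightarrow> nat \<Rightarrow> real" where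
  "gliding_hump T m t =
     (if t \<in> T then (1 - (\<Sum>s<t. m t s * gliding_hump T m s)) / m t t else 0)"

declare gliding_hump.simps [simp del]

lemma sum_gliding_hump:
  assumes "t \<in> T" "m t t \<noteq> 0"
  shows "(\<Sum>s\<le>t. m t s * gliding_hump T m s) = 1"
  using assms by (simp add: lessThan_Suc_atMost[symmetric] gliding_hump.simps[of T m t])

text \<open>If all supports lie in one finite set, convergence against test functions forces the
  norms to 0. Otherwise the supports meet an infinite summable set \<open>A\<close> infinitely
  often, and a function living on \<open>A\<close> gets integral 1 against infinitely many of the
  measures.\<close>

lemma not_JNP_summable_filter:
  assumes nn: "\<And>x. 0 \<le> w x" and small: "\<And>e. 0 < e \<Longrightarrow> finite {k. w k > e}"
  shows "\<not> JNP (filter_space (summable_filter w))"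
proof
  assume "JNP (filter_space (summable_filter w))"
  then obtain \<mu> where norm: "\<And>n. fs_norm (\<mu> n) = 1"
    and lim: "\<And>f. continuous_map (filter_space (summable_filter w)) euclideanreal f \<Longrightarrow>
      (\<lambda>n. fs_integral (\<mu> n) f) \<longlonglongrightarrow> 0"
    unfolding JNP_def by blast
  \<comment> \<open>Every nonconstant test function below is continuous because it is constant off a
    set of the ideal.\<close>
  have cont: "continuous_map (filter_space (summable_filter w)) euclideanreal f"
    if "w summable_on A" "\<And>k. k \<notin> A \<Longrightarrow> f (Some k) = f None" for f A
    using that by (auto simp: continuous_map_filter_space mem_filter_sets_summable_filter
        intro!: summable_on_subset_banach[of w A])
  let ?m = "\<lambda>n. Poly_Mapping.lookup (\<mu> n)"
  define S where "S n = {k. Some k \<in> Poly_Mapping.keys (\<mu> n)}" for n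
  have fin: "finite (S n)" for n
    using finite_vimageI[of "Poly_Mapping.keys (\<mu> n)" Some] by (simp add: S_def vimage_def)
  show False
  proof (cases "finite (\<Union>n. S n)")
    case True
    let ?U = "\<Union>n. S n" and ?K = "insert None (Some ` (\<Union>n. S n))"
    have keys: "Poly_Mapping.keys (\<mu> n) \<subseteq> ?K" for n
    proof
      show "x \<in> ?K" if "x \<in> Poly_Mapping.keys (\<mu> n)" for x
        using that by (cases x) (auto simp: S_def)
    qed
    have Some: "(\<lambda>n. ?m n (Some k)) \<longlonglongrightarrow> 0" for k
    proof -
      let ?f = "\<lambda>x. if x = Some k then 1 else 0 :: real"
      have "fs_integral (\<mu> n) ?f = ?m n (Some k)" for n
        by (subst fs_integral_superset[of "{Some k}"]) auto
      then show ?thesis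
        using lim[OF cont[of "{k}" ?f]] by simp
    qed
    \<comment> \<open>The indicator of \<open>None\<close> need not be continuous, so the weight
      there is recovered from the constant 1, whose integral is the sum of all weights.\<close>
    have "fs_integral (\<mu> n) (\<lambda>_. 1) = ?m n None + (\<Sum>k\<in>?U. ?m n (Some k))" for n
      using True keys[of n] by (subst fs_integral_superset[of ?K]) (auto simp: sum.reindex)
    then have "?m n None = fs_integral (\<mu> n) (\<lambda>_. 1) - (\<Sum>k\<in>?U. ?m n (Some k))" for n
      by simp
    moreover have "(\<lambda>n. fs_integral (\<mu> n) (\<lambda>_. 1) - (\<Sum>k\<in>?U. ?m n (Some k))) \<longlonglongrightarrow> 0 - (\<Sum>k\<in>?U. 0)"
      by (intro tendsto_diff lim tendsto_sum Some) simp
    ultimately have None: "(\<lambda>n. ?m n None) \<longlonglongrightarrow> 0" by simp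
    have "(\<lambda>n. \<Sum>x\<in>?K. \<bar>?m n x\<bar>) \<longlonglongrightarrow> (\<Sum>x\<in>?K. \<bar>0\<bar>)"
      by (intro tendsto_sum tendsto_rabs) (use Some None in auto)
    moreover have "(\<Sum>x\<in>?K. \<bar>?m n x\<bar>) = 1" for n
    proof -
      have "fs_norm (\<mu> n) = (\<Sum>x\<in>?K. \<bar>?m n x\<bar>)"
        unfolding fs_norm_def using True keys[of n]
        by (intro sum.mono_neutral_left) (auto simp: in_keys_iff)
      then show ?thesis using norm by simp
    qed
    ultimately show False
      by (simp add: LIMSEQ_const_iff)
  next
    case False
    have "finite {k \<in> (\<Union>n. S n). w k > e}" if "0 < e" for e
      by (rule finite_subset[OF _ small[OF that]]) auto
    from infinite_summable_subset[OF nn False this]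
    obtain A where A: "A \<subseteq> (\<Union>n. S n)" "infinite A" "w summable_on A" by blast
    \<comment> \<open>Only the last points of the supports matter; distinct ones come from distinct measures.\<close>
    define T where "T = {Max (S n \<inter> A) | n. S n \<inter> A \<noteq> {}}"
    have Max: "Max (S n \<inter> A) \<in> S n \<inter> A" if "S n \<inter> A \<noteq> {}" for n
      using that fin[of n] by (intro Max_in) auto
    have "T \<subseteq> A" using Max by (auto simp: T_def)
    have "infinite T"
      unfolding infinite_nat_iff_unbounded_le
    proof
      fix i
      obtain a where a: "a \<in> A" "i \<le> a"
        using A(2) unfolding infinite_nat_iff_unbounded_le by blast
      then obtain n where "a \<in> S n \<inter> A" using A(1) by blast
      then have "a \<le> Max (S n \<inter> A)" "Max (S n \<inter> A) \<in> T"
        using fin[of n] by (auto simp: T_def)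
      then show "\<exists>t\<ge>i. t \<in> T" using a by (meson order_trans)
    qed
    have "\<forall>t\<in>T. \<exists>n. S n \<inter> A \<noteq> {} \<and> Max (S n \<inter> A) = t"
      by (auto simp: T_def)
    then obtain N where N: "\<And>t. t \<in> T \<Longrightarrow> S (N t) \<inter> A \<noteq> {} \<and> Max (S (N t) \<inter> A) = t"
      by metis
    define h where "h = gliding_hump T (\<lambda>t s. ?m (N t) (Some s))"
    let ?f = "\<lambda>x. case x of None \<Rightarrow> 0 | Some k \<Rightarrow> h k"
    have h0: "h k = 0" if "k \<notin> T" for k
      using that by (simp add: h_def gliding_hump.simps)
    have one: "fs_integral (\<mu> (N t)) ?f = 1" if t: "t \<in> T" for t
    proof -
      \<comment> \<open>By maximality of \<open>t\<close>, support points beyond \<open>t\<close>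
        avoid \<open>A\<close>, where \<open>h\<close> lives; at \<open>None\<close> the value is
        0.\<close>
      have "?f x = 0" if x: "x \<in> Poly_Mapping.keys (\<mu> (N t))" "x \<notin> Some ` {..t}" for x
      proof (cases x)
        case (Some k)
        have "k \<notin> A"
        proof
          assume "k \<in> A"
          then have "k \<le> Max (S (N t) \<inter> A)"
            using x Some fin by (intro Max_ge) (auto simp: S_def)
          then show False using x Some N[OF t] by auto
        qed
        then show ?thesis using h0 \<open>T \<subseteq> A\<close> Some by auto
      qed simp
      then have "fs_integral (\<mu> (N t)) ?f = (\<Sum>s\<le>t. ?m (N t) (Some s) * h s)"
        by (subst fs_integral_superset[of "Some ` {..t}"]) (auto simp: sum.reindex)
      also have "\<dots> = 1"
        \<comment> \<open>The diagonal coefficient is nonzero because \<open>t\<close> belongs to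
          the support of its measure.\<close>
        unfolding h_def using t Max[of "N t"] N[OF t]
        by (intro sum_gliding_hump[where m = "\<lambda>t s. ?m (N t) (Some s)"])
          (auto simp: S_def in_keys_iff)
      finally show ?thesis .
    qed
    have "continuous_map (filter_space (summable_filter w)) euclideanreal ?f"
      using h0 \<open>T \<subseteq> A\<close> by (intro cont[OF A(3)]) auto
    from LIMSEQ_D[OF lim[OF this], of 1]
    obtain n0 where n0: "\<And>n. n \<ge> n0 \<Longrightarrow> \<bar>fs_integral (\<mu> n) ?f\<bar> < 1" by auto
    have "N ` T \<subseteq> {..<n0}"
    proof
      fix n assume "n \<in> N ` T"
      then have "fs_integral (\<mu> n) ?f = 1" using one by auto
      then show "n \<in> {..<n0}" using n0[of n] by (cases "n0 \<le> n") auto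
    qed
    moreover have "inj_on N T" by (rule inj_onI) (metis N)
    ultimately show False
      using \<open>infinite T\<close> by (meson finite_lessThan finite_subset finite_imageD)
  qed
qed


section \<open>Block weights\<close>

text \<open>The quadratic exponent gives consecutive sizes the ratio \<open>2 ^ (2 * n + 1)\<close>,
  so \<open>block_size n\<close> points of weight \<open>1 / block_size (Suc n)\<close> have total
  mass at most \<open>(1/2) ^ n\<close>.\<close>

definition block_size :: "nat \<Rightarrow> nat" where
  "block_size n = 2 ^ (n * n)"

text \<open>Starting at its own size, a block ends before the next one begins and lies beyond its
  index.\<close>

definition block :: "nat \<Rightarrow> nat set" where
  "block n = {block_size n..<2 * block_size n}"

lemma block_size_pos [simp]: "0 < block_size n"
  by (simp add: block_size_def)

lemma less_block_size: "n < block_size n"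
proof -
  have "n < 2 ^ n" by (rule less_exp)
  also have "\<dots> \<le> (2 :: nat) ^ (n * n)" by (intro power_increasing le_square) simp
  finally show ?thesis by (simp add: block_size_def)
qed

lemma block_size_Suc: "block_size (Suc n) = 2 ^ (2 * n + 1) * block_size n"
proof -
  have "Suc n * Suc n = (2 * n + 1) + n * n" by simp
  then show ?thesis by (simp only: block_size_def power_add)
qed

lemma block_size_double:
  assumes "m < n" shows "2 * block_size m \<le> block_size n"
proof -
  have "Suc m * Suc m \<le> n * n" using assms by (intro mult_le_mono) auto
  then have "Suc (m * m) \<le> n * n" by simp
  then have "2 ^ Suc (m * m) \<le> (2 :: nat) ^ (n * n)" by (rule power_increasing) simp
  then show ?thesis by (simp add: block_size_def)
qed

text \<open>Since block \<open>m\<close> ends at \<open>2 * block_size m\<close>, the factor 8 puts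
  it below a quarter of \<open>block_size n\<close>.\<close>

lemma block_size_octuple:
  assumes "m < n" "2 \<le> n" shows "8 * block_size m \<le> block_size n"
proof -
  obtain j where j: "n = Suc j" "m \<le> j" "1 \<le> j" using assms by (cases n) auto
  then have "m * m \<le> j * j" by (intro mult_le_mono) auto
  then have "m * m + 3 \<le> n * n" using j by simp
  then have "2 ^ (m * m + 3) \<le> (2 :: nat) ^ (n * n)" by (rule power_increasing) simp
  then show ?thesis by (simp add: block_size_def power_add)
qed

lemma finite_block [simp]: "finite (block n)"
  by (simp add: block_def)

lemma card_block [simp]: "card (block n) = block_size n"
  by (simp add: block_def)

lemma block_subset_atLeast: "block n \<subseteq> {n..}"
  using less_block_size[of n] by (auto simp: block_def)

lemma block_unique:
  assumes "k \<in> block m" "k \<in> block n" shows "m = n"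
  using assms block_size_double[of m n] block_size_double[of n m]
  by (cases m n rule: linorder_cases) (auto simp: block_def)

lemma infinite_Compl_blocks: "infinite (- \<Union>(range block))"
  unfolding infinite_nat_iff_unbounded_le
proof
  fix i
  \<comment> \<open>The endpoint of a block falls into the gap before the next. The index is shifted
    because blocks 0 and 1 are adjacent.\<close>
  have "2 * block_size (Suc i) \<notin> block m" for m
    using block_size_double[of m "Suc i"] block_size_octuple[of "Suc i" m]
      block_size_pos[of "Suc i"]
    by (cases m "Suc i" rule: linorder_cases) (auto simp: block_def simp del: block_size_pos)
  then show "\<exists>k\<ge>i. k \<in> - \<Union>(range block)"
    using less_block_size[of "Suc i"] by (intro exI[of _ "2 * block_size (Suc i)"]) auto
qed

text \<open>The constant \<open>c\<close> separates the two families: \<open>c = 1\<close> yields a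
  convergent sequence, \<open>c = 0\<close> makes the weights tend to 0.\<close>

definition block_weight :: "nat set \<Rightarrow> real \<Rightarrow> nat \<Rightarrow> real" where
  "block_weight X c k = (if k \<in> \<Union>(range block)
     then let n = (THE n. k \<in> block n) in if n \<in> X then 1 / real (block_size n) else 0
     else c)"

lemma block_weight_block:
  assumes "k \<in> block n"
  shows "block_weight X c k = (if n \<in> X then 1 / real (block_size n) else 0)"
proof -
  have "(THE n. k \<in> block n) = n"
    using assms block_unique by blast
  then show ?thesis using assms by (auto simp: block_weight_def)
qed

lemma block_weight_off_blocks: "k \<notin> \<Union>(range block) \<Longrightarrow> block_weight X c k = c"
  by (simp add: block_weight_def)

lemma block_weight_nonneg: "0 \<le> c \<Longrightarrow> 0 \<le> block_weight X c k"
  by (simp add: block_weight_def Let_def)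

lemma finite_block_weight_gt:
  assumes "0 < e"
  shows "finite {k \<in> \<Union>(range block). block_weight X c k > e}"
proof -
  obtain M where M: "1 / e < real M" using reals_Archimedean2 by blast
  have "n < M" if "k \<in> block n" "block_weight X c k > e" for k n
  proof -
    have "e < 1 / real (block_size n)"
      using that assms by (auto simp: block_weight_block split: if_splits)
    then have "real (block_size n) < 1 / e"
      using assms by (simp add: field_simps)
    then show ?thesis using M less_block_size[of n] by linarith
  qed
  then have "{k \<in> \<Union>(range block). block_weight X c k > e} \<subseteq> (\<Union>n<M. block n)" by blast
  then show ?thesis by (rule finite_subset) simp
qed

lemma not_summable_block_weight:
  assumes "0 \<le> c" "infinite X"
  shows "\<not> block_weight X c summable_on UNIV"
proof
  assume "block_weight X c summable_on UNIV"
  from summable_on_tail[where e = 1, OF block_weight_nonneg[OF assms(1)] this]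
  obtain K where K: "\<And>G. finite G \<Longrightarrow> G \<subseteq> {K..} \<Longrightarrow> sum (block_weight X c) G < 1"
    by auto
  obtain n where n: "n \<in> X" "K \<le> n"
    using assms(2) unfolding infinite_nat_iff_unbounded_le by blast
  have "sum (block_weight X c) (block n) < 1"
    using block_subset_atLeast[of n] n by (intro K) auto
  moreover have "sum (block_weight X c) (block n) = 1"
    using n by (simp add: block_weight_block[of _ n])
  ultimately show False by simp
qed

text \<open>The weight for \<open>Y\<close>, transported to \<open>u\<close>, has the same summable
  sets as the weight for \<open>X\<close>. The sets \<open>C n\<close> for \<open>n\<close> in
  \<open>I\<close> together have finite \<open>u\<close>-mass, yet each has \<open>X\<close>-mass at
  least 1/2.\<close>

lemma not_isomorphic_block_weight:
  assumes c: "c \<in> {0, 1}" and XY: "infinite (X - Y)"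
  shows "\<not> filter_isomorphic (summable_filter (block_weight X c)) (summable_filter (block_weight Y c))"
proof
  let ?w = "block_weight X c"
  assume "filter_isomorphic (summable_filter ?w) (summable_filter (block_weight Y c))"
  then obtain g where g: "bij g"
    "\<And>B. ?w summable_on B \<longleftrightarrow> (\<lambda>k. block_weight Y c (g k)) summable_on B"
    by (rule filter_isomorphic_summable_filterE) blast
  define u where "u k = block_weight Y c (g k)" for k
  have wu: "?w summable_on B \<longleftrightarrow> u summable_on B" for B
    using g(2)[of B] by (simp add: u_def[abs_def])
  have w0: "0 \<le> ?w k" and u0: "0 \<le> u k" for k
    using c by (auto simp: u_def intro: block_weight_nonneg)
  \<comment> \<open>When \<open>c = 1\<close>, this catches the block points that \<open>g\<close>
    sends off all blocks.\<close>
  define E where "E = {k \<in> \<Union>(range block). 1 \<le> u k}"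
  \<comment> \<open>An infinite subset of \<open>E\<close> on which \<open>?w\<close> is summable would have infinite \<open>u\<close>-mass.\<close>
  have "finite E"
  proof (rule ccontr)
    assume "infinite E"
    moreover have "finite {k \<in> E. ?w k > e}" if "0 < e" for e
      by (rule finite_subset[OF _ finite_block_weight_gt[OF that, of X c]]) (auto simp: E_def)
    ultimately obtain A where A: "A \<subseteq> E" "infinite A" "?w summable_on A"
      using infinite_summable_subset[where w = ?w and E = E, OF w0] by blast
    from A(3) have "u summable_on A" by (simp add: wu)
    from summable_on_tail[where w = u and e = 1, OF u0 this]
    obtain K where K: "\<And>G. finite G \<Longrightarrow> G \<subseteq> A \<inter> {K..} \<Longrightarrow> sum u G < 1" by auto
    obtain k where "k \<in> A" "K \<le> k"
      using A(2) unfolding infinite_nat_iff_unbounded_le by blast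
    then show False using K[of "{k}"] A(1) by (auto simp: E_def)
  qed
  \<comment> \<open>The threshold makes \<open>card E\<close> at most a quarter of
    \<open>block_size n\<close> and ensures \<open>2 \<le> n\<close>, as
    \<open>block_size_octuple\<close> requires.\<close>
  define I where "I = (X - Y) \<inter> {4 * card E + 2..}"
  \<comment> \<open>The bound is the largest weight possible on blocks after the n-th.\<close>
  define C where "C n = {k \<in> block n. u k \<le> 1 / real (block_size (Suc n))}" for n
  have Cn: "block_size n \<le> 2 * card (C n)" if n: "n \<in> I" for n
  proof -
    let ?Q = "g -` {..<block_size n div 4}"
    have "block n - C n \<subseteq> E \<union> ?Q"
    proof
      fix k assume k: "k \<in> block n - C n"
      then have uk: "u k > 1 / real (block_size (Suc n))" by (auto simp: C_def)
      then have pos: "u k > 0" by (rule le_less_trans[rotated]) simp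
      show "k \<in> E \<union> ?Q"
      proof (cases "g k \<in> \<Union>(range block)")
        case False
        then have "u k = c" by (simp add: u_def block_weight_off_blocks)
        then show ?thesis using pos c k by (auto simp: E_def)
      next
        case True
        then obtain m where m: "g k \<in> block m" by blast
        then have mY: "m \<in> Y" "u k = 1 / real (block_size m)"
          using pos by (auto simp: u_def block_weight_block split: if_splits)
        \<comment> \<open>A non-negligible image lies in a block \<open>m\<close> with
          \<open>m \<le> n\<close>; \<open>m = n\<close> is impossible since \<open>n\<close> is not
          in \<open>Y\<close>. Hence it lies among the first \<open>block_size n div 4\<close>
          numbers.\<close>
        have "block_size m < block_size (Suc n)"
          using uk unfolding mY(2) by (simp add: field_simps)
        then have "m \<le> n" using block_size_double[of "Suc n" m] by (cases "Suc n = m") force+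
        moreover have "m \<noteq> n" using mY n by (auto simp: I_def)
        ultimately have "8 * block_size m \<le> block_size n"
          using n by (intro block_size_octuple) (auto simp: I_def)
        moreover have "g k < 2 * block_size m" using m by (simp add: block_def)
        ultimately show ?thesis by auto
      qed
    qed
    moreover have Q: "finite ?Q" "card ?Q = block_size n div 4"
      using g(1) by (auto simp: finite_vimageI bij_def card_vimage_inj)
    ultimately have "card (block n - C n) \<le> card (E \<union> ?Q)"
      using \<open>finite E\<close> by (intro card_mono) auto
    also have "\<dots> \<le> card E + block_size n div 4"
      using card_Un_le[of E ?Q] Q by simp
    finally have "card (block n) - card (C n) \<le> card E + block_size n div 4"
      by (subst (asm) card_Diff_subset) (auto simp: C_def)
    moreover have "4 * card E \<le> block_size n"
      using n less_block_size[of n] by (auto simp: I_def)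
    ultimately show ?thesis by simp
  qed
  have "u summable_on (\<Union>n\<in>I. C n)"
  proof (rule summable_on_UN_geometric[OF u0])
    fix n G assume G: "finite G" "G \<subseteq> C n"
    then have "card G \<le> card (block n)"
      by (intro card_mono) (auto simp: C_def)
    have "sum u G \<le> real (card G) * (1 / real (block_size (Suc n)))"
      using G by (intro sum_bounded_above) (auto simp: C_def)
    also have "\<dots> \<le> real (block_size n) * (1 / real (block_size (Suc n)))"
      using \<open>card G \<le> card (block n)\<close> by (intro mult_right_mono) auto
    also have "\<dots> = (1/2) ^ (2 * n + 1)"
      by (simp add: block_size_Suc power_divide)
    also have "\<dots> \<le> (1/2) ^ n"
      by (rule power_decreasing) auto
    finally show "sum u G \<le> (1/2) ^ n" .
  qed
  then have "?w summable_on (\<Union>n\<in>I. C n)" by (simp add: wu)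
  \<comment> \<open>At least half of block \<open>n\<close> lies in \<open>C n\<close>, with weight
    \<open>1 / block_size n\<close> per point, so the mass cannot drop below 1/2.\<close>
  from summable_on_tail[where e = "1/2", OF w0 this]
  obtain K where K: "\<And>G. finite G \<Longrightarrow> G \<subseteq> (\<Union>n\<in>I. C n) \<inter> {K..} \<Longrightarrow> sum ?w G < 1/2" by auto
  have "infinite ((X - Y) - {..<max K (4 * card E + 2)})"
    using XY by simp
  then obtain n where "n \<in> (X - Y) - {..<max K (4 * card E + 2)}"
    using infinite_imp_nonempty by blast
  then have n: "n \<in> I" "K \<le> n" "n \<in> X" by (auto simp: I_def)
  have "C n \<subseteq> block n" by (auto simp: C_def)
  then have fin: "finite (C n)" by (rule finite_subset) simp
  have "C n \<subseteq> {K..}"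
    using \<open>C n \<subseteq> block n\<close> block_subset_atLeast[of n] n by auto
  then have "sum ?w (C n) < 1/2"
    using n fin by (intro K) auto
  moreover have "sum ?w (C n) = (\<Sum>k\<in>C n. 1 / real (block_size n))"
    using n by (intro sum.cong) (auto simp: C_def block_weight_block)
  ultimately have "2 * real (card (C n)) < real (block_size n)"
    by (simp add: field_simps)
  then show False using Cn[OF n(1)] by linarith
qed

section \<open>Continuum many pairwise non-isomorphic filters\<close>

text \<open>An almost disjoint family indexed by the reals: the codes of the dyadic approximations
  of \<open>r\<close> form a branch of a tree, the level \<open>n\<close> being part of the
  code.\<close>

definition dyadic_branch :: "real \<Rightarrow> nat set" where
  "dyadic_branch r = range (\<lambda>n::nat. to_nat (n, \<lfloor>r * 2 ^ n\<rfloor>))"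

lemma infinite_dyadic_branch: "infinite (dyadic_branch r)"
proof -
  have "inj (\<lambda>n::nat. to_nat (n, \<lfloor>r * 2 ^ n\<rfloor>))"
    by (rule injI) simp
  then show ?thesis
    unfolding dyadic_branch_def by (rule range_inj_infinite)
qed

text \<open>Equal floors at level \<open>n\<close> force \<open>r\<close> and \<open>s\<close> to
  differ by less than \<open>1 / 2 ^ n\<close>, so two branches share finitely many levels.\<close>

lemma infinite_dyadic_branch_Diff:
  assumes "r \<noteq> s"
  shows "infinite (dyadic_branch r - dyadic_branch s)"
proof -
  obtain M where M: "1 / \<bar>r - s\<bar> < real M" using reals_Archimedean2 by blast
  have "dyadic_branch r \<inter> dyadic_branch s \<subseteq> (\<lambda>n::nat. to_nat (n, \<lfloor>r * 2 ^ n\<rfloor>)) ` {..<M}"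
  proof
    fix x assume "x \<in> dyadic_branch r \<inter> dyadic_branch s"
    then obtain n where n: "x = to_nat (n, \<lfloor>r * 2 ^ n\<rfloor>)" "\<lfloor>r * 2 ^ n\<rfloor> = \<lfloor>s * 2 ^ n\<rfloor>"
      by (auto simp: dyadic_branch_def)
    have "\<bar>r * 2 ^ n - s * 2 ^ n\<bar> < 1" using n(2) by linarith
    then have "\<bar>r - s\<bar> * 2 ^ n < 1"
      by (simp add: left_diff_distrib[symmetric] abs_mult)
    then have "2 ^ n < 1 / \<bar>r - s\<bar>" using assms by (simp add: field_simps)
    moreover have "real n < 2 ^ n" by (rule of_nat_less_two_power)
    ultimately have "n < M" using M by linarith
    then show "x \<in> (\<lambda>n::nat. to_nat (n, \<lfloor>r * 2 ^ n\<rfloor>)) ` {..<M}" using n(1) by blast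
  qed
  then have "finite (dyadic_branch r \<inter> dyadic_branch s)"
    by (rule finite_subset) simp
  from Diff_infinite_finite[OF this infinite_dyadic_branch[of r]]
  show ?thesis by (simp add: Diff_Int)
qed

section \<open>The two families of filters\<close>

definition branch_filter :: "real \<Rightarrow> real \<Rightarrow> nat filter" where
  "branch_filter c r = summable_filter (block_weight (dyadic_branch r) c)"

lemma not_isomorphic_branch_filter:
  "c \<in> {0, 1} \<Longrightarrow> r \<noteq> s \<Longrightarrow> \<not> filter_isomorphic (branch_filter c r) (branch_filter c s)"
  unfolding branch_filter_def
  by (intro not_isomorphic_block_weight infinite_dyadic_branch_Diff)

lemma filter_isomorphic_refl: "filter_isomorphic F F"
  unfolding filter_isomorphic_def by (intro exI[of _ id]) auto

lemma branch_filter_family: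
  assumes "c \<in> {0, 1}"
  shows "range (branch_filter c) \<approx> (UNIV :: real set)"
    and "pairwise (\<lambda>F G. \<not> filter_isomorphic F G) (range (branch_filter c))"
    and "F \<in> range (branch_filter c) \<Longrightarrow> free_filter F \<and> fsigma_filter F \<and> P_filter F"
proof -
  \<comment> \<open>Equal filters are isomorphic, so non-isomorphism already makes the family as
    large as its index set.\<close>
  have "inj (branch_filter c)"
    by (rule injI) (metis not_isomorphic_branch_filter[OF assms] filter_isomorphic_refl)
  then show "range (branch_filter c) \<approx> (UNIV :: real set)"
    by (rule inj_on_image_eqpoll_self)
  show "pairwise (\<lambda>F G. \<not> filter_isomorphic F G) (range (branch_filter c))"
    by (rule pairwise_imageI) (rule not_isomorphic_branch_filter[OF assms])
  have c: "0 \<le> c" using assms by auto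
  show "free_filter F \<and> fsigma_filter F \<and> P_filter F" if "F \<in> range (branch_filter c)"
    using that by (auto simp: branch_filter_def block_weight_nonneg[OF c] infinite_dyadic_branch
        intro!: free_summable_filter fsigma_summable_filter P_summable_filter
          not_summable_block_weight[OF c])
qed

lemma JNP_branch_filter: "JNP (filter_space (branch_filter 1 r))"
  unfolding branch_filter_def
  by (rule JNP_summable_filter[OF block_weight_nonneg infinite_Compl_blocks])
    (auto intro: block_weight_off_blocks)

lemma BJNP_branch_filter: "BJNP (filter_space (branch_filter 0 r))"
  unfolding branch_filter_def
\<comment> \<open>Only blocks with index in the branch carry mass; enumerating the branch selects
  them and pushes the n-th one beyond \<open>n\<close>.\<close>
proof (rule BJNP_summable_filter[where B = "\<lambda>n. block (enumerate (dyadic_branch r) n)"])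
  fix n
  let ?e = "enumerate (dyadic_branch r) n"
  have X: "?e \<in> dyadic_branch r" "n \<le> ?e"
    using infinite_dyadic_branch by (auto intro: enumerate_in_set le_enumerate)
  show "block ?e \<noteq> {}"
    using card_block[of ?e] block_size_pos[of ?e] by (metis card.empty less_irrefl)
  show "block ?e \<subseteq> {n..}"
    using block_subset_atLeast[of ?e] X by auto
  show "block_weight (dyadic_branch r) 0 k = 1 / card (block ?e)" if "k \<in> block ?e" for k
    using X by (simp add: block_weight_block[OF that])
qed (simp_all add: block_weight_nonneg)

lemma not_JNP_branch_filter: "\<not> JNP (filter_space (branch_filter 0 r))"
  unfolding branch_filter_def
proof (rule not_JNP_summable_filter)
  fix e :: real assume e: "0 < e"
  show "finite {k. block_weight (dyadic_branch r) 0 k > e}"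
    by (rule finite_subset[OF _ finite_block_weight_gt[OF e, of "dyadic_branch r" 0]])
      (use e in \<open>auto simp: block_weight_def[of _ _ k for k]\<close>)
qed (simp add: block_weight_nonneg)

theorem corollary1p1:
  "\<exists>\<F>\<^sub>1 \<F>\<^sub>2 :: nat filter set.
     \<F>\<^sub>1 \<approx> (UNIV :: real set) \<and> \<F>\<^sub>2 \<approx> (UNIV :: real set) \<and>
     pairwise (\<lambda>F G. \<not> filter_isomorphic F G) \<F>\<^sub>1 \<and>
     pairwise (\<lambda>F G. \<not> filter_isomorphic F G) \<F>\<^sub>2 \<and>
     (\<forall>F \<in> \<F>\<^sub>1 \<union> \<F>\<^sub>2. free_filter F \<and> fsigma_filter F \<and> P_filter F) \<and>
     (\<forall>F \<in> \<F>\<^sub>1. JNP (filter_space F)) \<and>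
     (\<forall>F \<in> \<F>\<^sub>2. BJNP (filter_space F) \<and> \<not> JNP (filter_space F))"
proof (rule exI[of _ "range (branch_filter 1)"], rule exI[of _ "range (branch_filter 0)"], intro conjI)
  have 0: "0 \<in> {0, 1 :: real}" and 1: "1 \<in> {0, 1 :: real}" by simp_all
  note family0 = branch_filter_family[OF 0] and family1 = branch_filter_family[OF 1]
  show "range (branch_filter 1) \<approx> (UNIV :: real set)" "range (branch_filter 0) \<approx> (UNIV :: real set)"
    by (rule family1(1) family0(1))+
  show "pairwise (\<lambda>F G. \<not> filter_isomorphic F G) (range (branch_filter 1))"
    "pairwise (\<lambda>F G. \<not> filter_isomorphic F G) (range (branch_filter 0))"
    by (rule family1(2) family0(2))+
  show "\<forall>F \<in> range (branch_filter 1) \<union> range (branch_filter 0).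
      free_filter F \<and> fsigma_filter F \<and> P_filter F"
    using family0(3) family1(3) by blast
  show "\<forall>F \<in> range (branch_filter 1). JNP (filter_space F)"
    using JNP_branch_filter by blast
  show "\<forall>F \<in> range (branch_filter 0). BJNP (filter_space F) \<and> \<not> JNP (filter_space F)"
    using BJNP_branch_filter not_JNP_branch_filter by blast
qed

end
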